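(* Let $X$ be a well-filtered space. The following conditions are equivalent: (1) $X$ is locally compact. (2) $\mathsf{K}(X)$ is a continuous semilattice, and the upper Vietoris topology and the Scott topology on $\mathsf{K}(X)$ coincide. (3) $\mathsf{K}(X)$ is a continuous semilattice, and the map $\xi_X^\sigma : X \to \Sigma\,\mathsf{K}(X)$, $x\mapsto \uparrow x$, is continuous. (4) $\mathsf{K}(X)$ is a continuous semilattice, and $X$ has property Q. (5) $X$ is core compact.
   Context: All spaces are $T_0$. The specialization order of a space $X$ is $x\le y$ iff $x\in\overline{\{y\}}$; $\uparrow x=\{y: x\le y\}$; a set is saturated iff it is an upper set in this order. $\mathsf{K}(X)$ denotes the set of all nonempty compact saturated subsets of $X$, ordered by reverse inclusion ($K_1\sqsubseteq K_2$ iff $K_2\subseteq K_1$); in this order, binary meets are unions, so $\mathsf{K}(X)$ is a semilattice, and a family $\{K_i\}$ has a supremum iff $\bigcap_i K_i\in\mathsf{K}(X)$, in which case the supremum is that intersection. For a poset $Q$, a subset $U$ is Scott open if it is an upper set and for every directed $D\subseteq Q$ whose supremum exists and lies in $U$, $D\cap U\neq\emptyset$; these sets form the Scott topology $\sigma(Q)$, and $\Sigma Q=(Q,\sigma(Q))$. In a poset, $a\ll b$ ($a$ way below $b$) means: for every directed $D$ whose supremum exists and $\bigvee D\ge b$, some $d\in D$ satisfies $d\ge a$. A poset is continuous if it is directed complete and for every $x$ the set $\{u: u\ll x\}$ is directed with supremum $x$; "$\mathsf{K}(X)$ is a continuous semilattice" means $\mathsf{K}(X)$ (with the order above) is continuous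 in this sense. For an open set $U$ of $X$, $\Box U=\{K\in\mathsf{K}(X): K\subseteq U\}$; the upper Vietoris topology on $\mathsf{K}(X)$ is the topology with base $\{\Box U: U \text{ open in } X\}$. A $T_0$ space $X$ is well-filtered if for every open $U$ and every family $\mathcal{K}\subseteq \mathsf{K}(X)$ directed with respect to $\sqsubseteq$ (i.e. filtered under inclusion), $\bigcap\mathcal K\subseteq U$ implies $K\subseteq U$ for some $K\in\mathcal K$. $X$ has property Q if for all $K_1,K_2\in\mathsf{K}(X)$: $K_1\ll K_2$ in $\mathsf{K}(X)$ iff $K_2\subseteq \operatorname{int}K_1$. $X$ is locally compact if every point has a neighborhood base consisting of compact sets; $X$ is core compact if its lattice of open sets $\mathcal O(X)$ is a continuous lattice. *)

theory Defs
  imports "HOL-Analysis.Analysis"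
begin

definition spec_le :: "'a topology \<Rightarrow> 'a \<Rightarrow> 'a \<Rightarrow> bool" where
  "spec_le X x y \<longleftrightarrow> x \<in> X closure_of {y}"

definition upset :: "'a topology \<Rightarrow> 'a \<Rightarrow> 'a set" where
  "upset X x = {y \<in> topspace X. spec_le X x y}"

definition saturated :: "'a topology \<Rightarrow> 'a set \<Rightarrow> bool" where
  "saturated X A \<longleftrightarrow> A \<subseteq> topspace X \<and>
     (\<forall>x\<in>A. \<forall>y\<in>topspace X. spec_le X x y \<longrightarrow> y \<in> A)"

definition KX :: "'a topology \<Rightarrow> 'a set set" where
  "KX X = {K. K \<noteq> {} \<and> compactin X K \<and> saturated X K}"

definition kle :: "'a set \<Rightarrow> 'a set \<Rightarrow> bool" where
  "kle K1 K2 \<longleftrightarrow> K2 \<subseteq> K1"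

definition directed_in :: "'b set \<Rightarrow> ('b \<Rightarrow> 'b \<Rightarrow> bool) \<Rightarrow> 'b set \<Rightarrow> bool" where
  "directed_in P le D \<longleftrightarrow> D \<subseteq> P \<and> D \<noteq> {} \<and>
     (\<forall>a\<in>D. \<forall>b\<in>D. \<exists>c\<in>D. le a c \<and> le b c)"

definition is_lub_in :: "'b set \<Rightarrow> ('b \<Rightarrow> 'b \<Rightarrow> bool) \<Rightarrow> 'b set \<Rightarrow> 'b \<Rightarrow> bool" where
  "is_lub_in P le D s \<longleftrightarrow> s \<in> P \<and> (\<forall>d\<in>D. le d s) \<and>
     (\<forall>u\<in>P. (\<forall>d\<in>D. le d u) \<longrightarrow> le s u)"

definition scott_open :: "'b set \<Rightarrow> ('b \<Rightarrow> 'b \<Rightarrow> bool) \<Rightarrow> 'b set \<Rightarrow> bool" where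
  "scott_open P le U \<longleftrightarrow> U \<subseteq> P \<and>
     (\<forall>x\<in>U. \<forall>y\<in>P. le x y \<longrightarrow> y \<in> U) \<and>
     (\<forall>D s. directed_in P le D \<and> is_lub_in P le D s \<and> s \<in> U \<longrightarrow> D \<inter> U \<noteq> {})"

definition way_below :: "'b set \<Rightarrow> ('b \<Rightarrow> 'b \<Rightarrow> bool) \<Rightarrow> 'b \<Rightarrow> 'b \<Rightarrow> bool" where
  "way_below P le a b \<longleftrightarrow>
     (\<forall>D s. directed_in P le D \<and> is_lub_in P le D s \<and> le b s \<longrightarrow> (\<exists>d\<in>D. le a d))"

definition dcpo_on :: "'b set \<Rightarrow> ('b \<Rightarrow> 'b \<Rightarrow> bool) \<Rightarrow> bool" where
  "dcpo_on P le \<longleftrightarrow> (\<forall>D. directed_in P le D \<longrightarrow> (\<exists>s. is_lub_in P le D s))"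

definition continuous_poset :: "'b set \<Rightarrow> ('b \<Rightarrow> 'b \<Rightarrow> bool) \<Rightarrow> bool" where
  "continuous_poset P le \<longleftrightarrow> dcpo_on P le \<and>
     (\<forall>x\<in>P. directed_in P le {u\<in>P. way_below P le u x} \<and>
             is_lub_in P le {u\<in>P. way_below P le u x} x)"

definition box :: "'a topology \<Rightarrow> 'a set \<Rightarrow> 'a set set" where
  "box X U = {K \<in> KX X. K \<subseteq> U}"

definition upper_vietoris :: "'a topology \<Rightarrow> 'a set topology" where
  "upper_vietoris X = topology_generated_by {box X U | U. openin X U}"

definition well_filtered :: "'a topology \<Rightarrow> bool" where
  "well_filtered X \<longleftrightarrow>
     (\<forall>U \<K>. openin X U \<and> directed_in (KX X) kle \<K> \<and> \<Inter>\<K> \<subseteq> U \<longrightarrow> (\<exists>K\<in>\<K>. K \<subseteq> U))"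

definition property_Q :: "'a topology \<Rightarrow> bool" where
  "property_Q X \<longleftrightarrow>
     (\<forall>K1\<in>KX X. \<forall>K2\<in>KX X. way_below (KX X) kle K1 K2 \<longleftrightarrow> K2 \<subseteq> X interior_of K1)"

definition locally_compact_nb :: "'a topology \<Rightarrow> bool" where
  "locally_compact_nb X \<longleftrightarrow>
     (\<forall>x\<in>topspace X. \<forall>U. openin X U \<and> x \<in> U \<longrightarrow>
        (\<exists>V K. openin X V \<and> compactin X K \<and> x \<in> V \<and> V \<subseteq> K \<and> K \<subseteq> U))"

definition core_compact :: "'a topology \<Rightarrow> bool" where
  "core_compact X \<longleftrightarrow> continuous_poset {U. openin X U} (\<subseteq>)"

end

theory Submission
  imports Defs
begin

text \<open>
  The only implication that is not routine is that core compactness implies local compactness. Given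
  \<open>V \<lless> U\<close> in the lattice of open sets, interpolation yields \<open>U = W\<^sub>0 \<ggreater> W\<^sub>1 \<ggreater> \<dots>\<close> with every \<open>W\<^sub>n\<close>
  above \<open>V\<close>, and \<open>K = \<Inter>\<^sub>n W\<^sub>n\<close> is compact as soon as every open \<open>G \<supseteq> K\<close> contains some \<open>W\<^sub>n\<close>.
  Otherwise choose a maximal open \<open>M \<supseteq> G\<close> containing no \<open>W\<^sub>n\<close>, and points \<open>x\<^sub>n \<in> W\<^sub>n - M\<close>. By
  maximality an open set containing one \<open>x\<^sub>k\<close> contains almost all \<open>x\<^sub>n\<close>, so all tails of the sequence
  are compact, and well-filteredness applied to their saturations puts some \<open>x\<^sub>m\<close> into \<open>G\<close>.
\<close>

section \<open>The way-below relation in an arbitrary poset\<close>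

lemma directed_in_subset: "directed_in P le D \<Longrightarrow> D \<subseteq> P"
  unfolding directed_in_def by simp

lemma way_belowD:
  assumes "way_below P le a b" "directed_in P le D" "is_lub_in P le D s" "le b s"
  shows "\<exists>d\<in>D. le a d"
  using assms unfolding way_below_def by blast

lemma way_below_le_trans:
  assumes "way_below P le a b" "le b c" "transp le"
  shows "way_below P le a c"
  using assms unfolding way_below_def by (meson transpD)

lemma le_way_below_trans:
  assumes "le a b" "way_below P le b c" "transp le"
  shows "way_below P le a c"
  using assms unfolding way_below_def by (meson transpD)

lemma continuous_posetD:
  assumes "continuous_poset P le" "x \<in> P"
  shows "directed_in P le {u\<in>P. way_below P le u x}"
    and "is_lub_in P le {u\<in>P. way_below P le u x} x"
  using assms unfolding continuous_poset_def by blast+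

text \<open>The elements that are way below something way below \<open>b\<close> form a directed set
  \<open>D\<close> with supremum \<open>b\<close>. Testing \<open>a\<close> way below
  \<open>b\<close> against \<open>D\<close> puts \<open>a\<close> below some \<open>d\<close> in
  \<open>D\<close>, and the intermediate element witnessing \<open>d \<in> D\<close>
  interpolates.\<close>

lemma way_below_interpolation:
  assumes P: "continuous_poset P le" and tr: "transp le" and re: "reflp le"
    and ab: "way_below P le a b" and b: "b \<in> P"
  obtains c where "c \<in> P" "way_below P le a c" "way_below P le c b"
proof -
  define D where "D = {u\<in>P. \<exists>c\<in>P. way_below P le u c \<and> way_below P le c b}"
  have ne: "\<exists>u\<in>P. way_below P le u x" if "x \<in> P" for x
    using continuous_posetD(1)[OF P that] unfolding directed_in_def by blast
  have dir: "\<exists>w\<in>P. way_below P le w x \<and> le u w \<and> le v w"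
    if "x \<in> P" "u \<in> P" "v \<in> P" "way_below P le u x" "way_below P le v x" for x u v
    using continuous_posetD(1)[OF P that(1)] that unfolding directed_in_def by blast
  have "D \<noteq> {}"
    using ne[OF b] ne unfolding D_def by blast
  moreover have "\<exists>w\<in>D. le u w \<and> le v w" if uv: "u \<in> D" "v \<in> D" for u v
  proof -
    obtain c d where cd: "c \<in> P" "way_below P le u c" "way_below P le c b"
        "d \<in> P" "way_below P le v d" "way_below P le d b"
      using uv unfolding D_def by blast
    \<comment> \<open>Directedness is used twice: first the intermediate elements \<open>c\<close>
      and \<open>d\<close> are bounded by some \<open>e\<close> way below \<open>b\<close>, then
      \<open>u\<close> and \<open>v\<close>, now both way below \<open>e\<close>, are bounded by
      some \<open>w\<close> way below \<open>e\<close>.\<close>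
    obtain e where e: "e \<in> P" "way_below P le e b" "le c e" "le d e"
      using dir[of b c d] cd b by blast
    have "way_below P le u e" "way_below P le v e"
      using way_below_le_trans tr cd e by metis+
    then obtain w where "w \<in> P" "way_below P le w e" "le u w" "le v w"
      using dir[of e u v] e(1) uv unfolding D_def by blast
    then show ?thesis
      using e unfolding D_def by blast
  qed
  moreover have "D \<subseteq> P"
    unfolding D_def by blast
  ultimately have "directed_in P le D"
    unfolding directed_in_def by blast
  moreover have "is_lub_in P le D b"
  proof -
    have "le u b" if u: "u \<in> D" for u
    proof -
      obtain c where c: "c \<in> P" "way_below P le u c" "way_below P le c b"
        using u unfolding D_def by blast
      have "u \<in> P"
        using u unfolding D_def by blast
      then have "le u c" "le c b"
        using c continuous_posetD(2)[OF P c(1)] continuous_posetD(2)[OF P b]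
        unfolding is_lub_in_def by blast+
      then show ?thesis
        using tr by (meson transpD)
    qed
    moreover have "le b v" if v: "v \<in> P" "\<forall>d\<in>D. le d v" for v
    proof -
      \<comment> \<open>An upper bound of \<open>D\<close> bounds everything way below
        \<open>c\<close>, hence \<open>c\<close> itself as their supremum; as \<open>c\<close> is
        arbitrary way below \<open>b\<close>, it then bounds \<open>b\<close>.\<close>
      have "le c v" if c: "c \<in> P" "way_below P le c b" for c
      proof -
        have "\<forall>u\<in>{u\<in>P. way_below P le u c}. le u v"
          using v c unfolding D_def by blast
        then show ?thesis
          using continuous_posetD(2)[OF P c(1)] v(1) unfolding is_lub_in_def by blast
      qed
      then show ?thesis
        using continuous_posetD(2)[OF P b] v(1) unfolding is_lub_in_def by blast
    qed
    ultimately show ?thesis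
      using b unfolding is_lub_in_def by blast
  qed
  ultimately have "\<exists>d\<in>D. le a d"
    by (rule way_belowD[OF ab _ _ reflpD[OF re]])
  then show ?thesis
    using that le_way_below_trans[OF _ _ tr] unfolding D_def by blast
qed

text \<open>If \<open>a\<close> is way below the supremum of \<open>D\<close>, an interpolating
  \<open>c\<close> still has \<open>a\<close> way below it, and some member of \<open>D\<close>
  already lies above \<open>c\<close>.\<close>

lemma scott_open_way_above:
  assumes P: "continuous_poset P le" and tr: "transp le" and re: "reflp le"
  shows "scott_open P le {b\<in>P. way_below P le a b}"
  unfolding scott_open_def
proof (intro conjI allI impI ballI)
  fix x y assume "x \<in> {b\<in>P. way_below P le a b}" "y \<in> P" "le x y"
  then show "y \<in> {b\<in>P. way_below P le a b}"
    using way_below_le_trans[OF _ _ tr] by blast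
next
  fix D s assume D: "directed_in P le D \<and> is_lub_in P le D s \<and> s \<in> {b\<in>P. way_below P le a b}"
  then obtain c where c: "c \<in> P" "way_below P le a c" "way_below P le c s"
    using way_below_interpolation[OF P tr re] by blast
  have "\<exists>d\<in>D. le c d"
    using D way_belowD[OF c(3) _ _ reflpD[OF re]] by simp
  then obtain d where "d \<in> D" "le c d"
    by blast
  then show "D \<inter> {b\<in>P. way_below P le a b} \<noteq> {}"
    using D way_below_le_trans[OF c(2) _ tr] unfolding directed_in_def by blast
qed blast

lemma transp_kle: "transp kle" and reflp_kle: "reflp kle"
  unfolding kle_def by (auto intro: transpI reflpI)

section \<open>Saturations and compact saturated sets\<close>

lemma spec_le_iff:
  "spec_le X x y \<longleftrightarrow> x \<in> topspace X \<and> (\<forall>U. openin X U \<and> x \<in> U \<longrightarrow> y \<in> U)"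
  unfolding spec_le_def in_closure_of by blast

text \<open>The upper closure in the specialization order; for
  \<open>A \<subseteq> topspace X\<close> it is also the intersection of all open sets containing
  \<open>A\<close>.\<close>

definition saturation :: "'a topology \<Rightarrow> 'a set \<Rightarrow> 'a set" where
  "saturation X A = {y \<in> topspace X. \<exists>x\<in>A. spec_le X x y}"

lemma subset_saturation: "A \<subseteq> topspace X \<Longrightarrow> A \<subseteq> saturation X A"
  unfolding saturation_def spec_le_iff by blast

lemma saturation_mono: "A \<subseteq> B \<Longrightarrow> saturation X A \<subseteq> saturation X B"
  unfolding saturation_def by blast

lemma saturation_subset_open: "openin X U \<Longrightarrow> A \<subseteq> U \<Longrightarrow> saturation X A \<subseteq> U"
  unfolding saturation_def spec_le_iff by blast

text \<open>An open set that contains \<open>A\<close> contains its saturation, so a finite subcover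
  for \<open>A\<close> also covers the saturation.\<close>

lemma saturation_in_KX:
  assumes A: "compactin X A" "A \<noteq> {}"
  shows "saturation X A \<in> KX X"
proof -
  have sub: "A \<subseteq> saturation X A"
    by (rule subset_saturation[OF compactin_subset_topspace[OF A(1)]])
  have "compactin X (saturation X A)"
    unfolding compactin_def
  proof (intro conjI allI impI)
    show "saturation X A \<subseteq> topspace X"
      unfolding saturation_def by blast
    fix \<U> assume \<U>: "Ball \<U> (openin X) \<and> saturation X A \<subseteq> \<Union>\<U>"
    then obtain \<F> where \<F>: "finite \<F>" "\<F> \<subseteq> \<U>" "A \<subseteq> \<Union>\<F>"
      using A(1) sub unfolding compactin_def by (meson order_trans)
    then have "openin X (\<Union>\<F>)"
      using \<U> by blast
    then show "\<exists>\<F>. finite \<F> \<and> \<F> \<subseteq> \<U> \<and> saturation X A \<subseteq> \<Union>\<F>"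
      using \<F> saturation_subset_open by metis
  qed
  moreover have "saturated X (saturation X A)"
    unfolding saturated_def saturation_def spec_le_iff by blast
  ultimately show ?thesis
    using A(2) sub unfolding KX_def by blast
qed

lemma upset_eq_saturation: "upset X x = saturation X {x}"
  unfolding upset_def saturation_def by blast

lemma upset_in_KX: "x \<in> topspace X \<Longrightarrow> upset X x \<in> KX X"
  unfolding upset_eq_saturation by (rule saturation_in_KX) auto

lemma mem_upset: "x \<in> topspace X \<Longrightarrow> x \<in> upset X x"
  unfolding upset_def spec_le_iff by blast

lemma upset_subset_open: "openin X U \<Longrightarrow> x \<in> U \<Longrightarrow> upset X x \<subseteq> U"
  unfolding upset_eq_saturation by (simp add: saturation_subset_open)

text \<open>The complement of the closure of \<open>{y}\<close> serves as \<open>U\<close>: a point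
  of \<open>K\<close> in that closure would lie below \<open>y\<close> and force
  \<open>y \<in> K\<close>.\<close>

lemma saturated_separation:
  assumes "saturated X K" "y \<in> topspace X" "y \<notin> K"
  obtains U where "openin X U" "K \<subseteq> U" "y \<notin> U"
proof
  show "openin X (topspace X - X closure_of {y})"
    by (simp add: openin_diff)
  show "K \<subseteq> topspace X - X closure_of {y}"
    using assms unfolding saturated_def spec_le_def by blast
  show "y \<notin> topspace X - X closure_of {y}"
    using assms(2) by (simp add: in_closure_of)
qed

section \<open>Directed suprema and way-below in \<open>KX X\<close>\<close>

lemma is_lub_in_KX_Inter:
  assumes "\<Inter>D \<in> KX X"
  shows "is_lub_in (KX X) kle D s \<longleftrightarrow> s = \<Inter>D"
proof
  assume "is_lub_in (KX X) kle D s"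
  then have "s \<subseteq> \<Inter>D" "\<Inter>D \<subseteq> s"
    using assms unfolding is_lub_in_def kle_def by blast+
  then show "s = \<Inter>D" by blast
qed (use assms in \<open>auto simp: is_lub_in_def kle_def\<close>)

lemma well_filteredD:
  assumes "well_filtered X" "directed_in (KX X) kle \<K>" "openin X U" "\<Inter>\<K> \<subseteq> U"
  shows "\<exists>K\<in>\<K>. K \<subseteq> U"
  using assms unfolding well_filtered_def by blast

text \<open>Well-filteredness is applied to two open sets: the empty set, which gives nonemptiness,
  and the union of an open cover of the intersection. In the second case one member of the family is
  already covered, and its compactness gives the finite subcover.\<close>

lemma well_filtered_Inter_in_KX:
  assumes wf: "well_filtered X" and D: "directed_in (KX X) kle \<K>"
  shows "\<Inter>\<K> \<in> KX X"
proof -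
  have sub: "\<K> \<subseteq> KX X" and ne: "\<K> \<noteq> {}"
    using D unfolding directed_in_def by auto
  have "\<Inter>\<K> \<noteq> {}"
  proof
    assume "\<Inter>\<K> = {}"
    then obtain K where "K \<in> \<K>" "K \<subseteq> {}"
      using well_filteredD[OF wf D openin_empty] by auto
    then show False
      using sub unfolding KX_def by auto
  qed
  moreover have "saturated X (\<Inter>\<K>)"
    using sub ne unfolding KX_def saturated_def by blast
  moreover have "compactin X (\<Inter>\<K>)"
    unfolding compactin_def
  proof (intro conjI allI impI)
    show "\<Inter>\<K> \<subseteq> topspace X"
      using sub ne unfolding KX_def saturated_def by blast
    fix \<U> assume \<U>: "Ball \<U> (openin X) \<and> \<Inter>\<K> \<subseteq> \<Union>\<U>"
    then have "openin X (\<Union>\<U>)"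
      by blast
    then obtain K where K: "K \<in> \<K>" "K \<subseteq> \<Union>\<U>"
      using well_filteredD[OF wf D] \<U> by meson
    then have "compactin X K"
      using sub unfolding KX_def by blast
    then obtain \<F> where "finite \<F>" "\<F> \<subseteq> \<U>" "K \<subseteq> \<Union>\<F>"
      using \<U> K unfolding compactin_def by meson
    then show "\<exists>\<F>. finite \<F> \<and> \<F> \<subseteq> \<U> \<and> \<Inter>\<K> \<subseteq> \<Union>\<F>"
      using K(1) by blast
  qed
  ultimately show ?thesis
    unfolding KX_def by blast
qed

lemma well_filtered_lub_iff:
  assumes "well_filtered X" "directed_in (KX X) kle \<K>"
  shows "is_lub_in (KX X) kle \<K> s \<longleftrightarrow> s = \<Inter>\<K>"
  using is_lub_in_KX_Inter well_filtered_Inter_in_KX assms by metis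

text \<open>Directed suprema are intersections, so well-filteredness for the open set
  \<open>X interior_of K1\<close> puts a member of the family inside \<open>K1\<close>.\<close>

lemma way_below_KX_if_interior:
  assumes wf: "well_filtered X" and K: "K2 \<subseteq> X interior_of K1"
  shows "way_below (KX X) kle K1 K2"
  unfolding way_below_def
proof (intro allI impI)
  fix D s assume A: "directed_in (KX X) kle D \<and> is_lub_in (KX X) kle D s \<and> kle K2 s"
  then have "\<Inter>D \<subseteq> X interior_of K1"
    using well_filtered_lub_iff[OF wf] K unfolding kle_def by blast
  then obtain d where "d \<in> D" "d \<subseteq> X interior_of K1"
    using well_filteredD[OF wf _ openin_interior_of] A by meson
  then show "\<exists>d\<in>D. kle K1 d"
    unfolding kle_def using interior_of_subset[of X K1] by blast
qed

text \<open>By continuity \<open>upset X x\<close> is the filtered intersection of the compact sets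
  way below it; since it lies in \<open>U\<close>, well-filteredness puts one of these sets inside
  \<open>U\<close>. Both returns from \<open>KX X\<close> to local compactness start from such a
  set.\<close>

lemma continuous_KX_approx:
  assumes wf: "well_filtered X" and c: "continuous_poset (KX X) kle"
    and U: "openin X U" "x \<in> U"
  shows "\<exists>Q\<in>KX X. way_below (KX X) kle Q (upset X x) \<and> Q \<subseteq> U"
proof -
  have up: "upset X x \<in> KX X"
    using openin_subset[OF U(1)] U(2) upset_in_KX by (meson subsetD)
  note D = continuous_posetD[OF c up]
  have "\<Inter>{u \<in> KX X. way_below (KX X) kle u (upset X x)} \<subseteq> U"
    using well_filtered_lub_iff[OF wf D(1)] D(2) upset_subset_open[OF U] by simp
  then show ?thesis
    using well_filteredD[OF wf D(1) U(1)] by blast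
qed

section \<open>Locally compact spaces\<close>

text \<open>Finitely many open sets with compact hulls inside \<open>U\<close> cover
  \<open>K\<close>. The union of the hulls is compact, and saturating it does not leave the open set
  \<open>U\<close>.\<close>

lemma locally_compact_KX_between:
  assumes lc: "locally_compact_nb X" and K: "K \<in> KX X" and U: "openin X U" "K \<subseteq> U"
  shows "\<exists>Q\<in>KX X. K \<subseteq> X interior_of Q \<and> Q \<subseteq> U"
proof -
  have Kc: "compactin X K" "K \<noteq> {}"
    using K unfolding KX_def by auto
  define \<V> where "\<V> = {V. openin X V \<and> (\<exists>C. compactin X C \<and> V \<subseteq> C \<and> C \<subseteq> U)}"
  have "K \<subseteq> \<Union>\<V>"
  proof
    fix x assume "x \<in> K"
    then have "x \<in> topspace X" "x \<in> U"
      using U openin_subset[OF U(1)] by blast+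
    then obtain V C where "openin X V" "compactin X C" "x \<in> V" "V \<subseteq> C" "C \<subseteq> U"
      using lc U(1) unfolding locally_compact_nb_def by meson
    then show "x \<in> \<Union>\<V>"
      unfolding \<V>_def by blast
  qed
  moreover have "Ball \<V> (openin X)"
    unfolding \<V>_def by blast
  ultimately obtain \<F> where \<F>: "finite \<F>" "\<F> \<subseteq> \<V>" "K \<subseteq> \<Union>\<F>"
    using Kc unfolding compactin_def by meson
  have "\<forall>V\<in>\<F>. \<exists>C. compactin X C \<and> V \<subseteq> C \<and> C \<subseteq> U"
    using \<F>(2) unfolding \<V>_def by blast
  then obtain C where C: "\<And>V. V \<in> \<F> \<Longrightarrow> compactin X (C V) \<and> V \<subseteq> C V \<and> C V \<subseteq> U"
    by metis
  define A where "A = \<Union>(C ` \<F>)"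
  have "compactin X A"
    unfolding A_def using \<F>(1) C by (intro compactin_Union) auto
  have FA: "\<Union>\<F> \<subseteq> A" and AU: "A \<subseteq> U"
    unfolding A_def using C by blast+
  have "A \<noteq> {}"
    using Kc \<F>(3) FA by blast
  have Aop: "A \<subseteq> saturation X A"
    by (rule subset_saturation[OF compactin_subset_topspace[OF \<open>compactin X A\<close>]])
  have "openin X (\<Union>\<F>)"
    using \<F>(2) unfolding \<V>_def by blast
  then have "\<Union>\<F> \<subseteq> X interior_of (saturation X A)"
    using FA Aop by (intro interior_of_maximal) auto
  then show ?thesis
    using saturation_in_KX[OF \<open>compactin X A\<close> \<open>A \<noteq> {}\<close>] \<F>(3)
      saturation_subset_open[OF U(1) AU] by blast
qed

text \<open>Compact saturated neighborhoods of \<open>K\<close> are directed because one fits inside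
  the intersection of any two interiors. Their intersection is \<open>K\<close> because a point
  outside the saturated set \<open>K\<close> is missed by an open superset, hence by a neighborhood
  inside it.\<close>

lemma locally_compact_KX_approx:
  assumes lc: "locally_compact_nb X" and K: "K \<in> KX X"
  shows "directed_in (KX X) kle {Q \<in> KX X. K \<subseteq> X interior_of Q}"
    and "is_lub_in (KX X) kle {Q \<in> KX X. K \<subseteq> X interior_of Q} K"
proof -
  let ?D = "{Q \<in> KX X. K \<subseteq> X interior_of Q}"
  have K': "K \<subseteq> topspace X" "saturated X K"
    using K unfolding KX_def saturated_def by auto
  have "?D \<noteq> {}"
    using locally_compact_KX_between[OF lc K openin_topspace K'(1)] by blast
  moreover have "\<exists>c\<in>?D. kle a c \<and> kle b c" if ab: "a \<in> ?D" "b \<in> ?D" for a b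
  proof -
    have "openin X (X interior_of a \<inter> X interior_of b)" "K \<subseteq> X interior_of a \<inter> X interior_of b"
      using ab by auto
    then obtain Q where Q: "Q \<in> KX X" "K \<subseteq> X interior_of Q"
        "Q \<subseteq> X interior_of a \<inter> X interior_of b"
      using locally_compact_KX_between[OF lc K] by blast
    then have "Q \<subseteq> a" "Q \<subseteq> b"
      using interior_of_subset[of X a] interior_of_subset[of X b] by blast+
    then show ?thesis
      using Q unfolding kle_def by blast
  qed
  ultimately show "directed_in (KX X) kle ?D"
    unfolding directed_in_def by blast
  have "\<Inter>?D = K"
  proof
    show "K \<subseteq> \<Inter>?D"
      using interior_of_subset[of X] by (auto dest: subsetD)
    show "\<Inter>?D \<subseteq> K"
    proof
      fix y assume y: "y \<in> \<Inter>?D"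
      then have "y \<in> topspace X"
        using \<open>?D \<noteq> {}\<close> unfolding KX_def saturated_def by blast
      show "y \<in> K"
      proof (rule ccontr)
        assume "y \<notin> K"
        then obtain U where U: "openin X U" "K \<subseteq> U" "y \<notin> U"
          using saturated_separation K'(2) \<open>y \<in> topspace X\<close> by metis
        then show False
          using locally_compact_KX_between[OF lc K U(1,2)] y by blast
      qed
    qed
  qed
  then show "is_lub_in (KX X) kle ?D K"
    using is_lub_in_KX_Inter K by metis
qed

text \<open>Testing \<open>K1\<close> way below \<open>K2\<close> against the neighborhood family of
  \<open>K2\<close> yields a neighborhood of \<open>K2\<close> contained in
  \<open>K1\<close>.\<close>

lemma locally_compact_imp_property_Q:
  assumes wf: "well_filtered X" and lc: "locally_compact_nb X"
  shows "property_Q X"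
  unfolding property_Q_def
proof (intro ballI iffI)
  fix K1 K2 assume K: "K1 \<in> KX X" "K2 \<in> KX X" and wb: "way_below (KX X) kle K1 K2"
  note D = locally_compact_KX_approx[OF lc K(2)]
  obtain Q where "K2 \<subseteq> X interior_of Q" "Q \<subseteq> K1"
    using way_belowD[OF wb D] unfolding kle_def by blast
  then show "K2 \<subseteq> X interior_of K1"
    using interior_of_mono by blast
qed (rule way_below_KX_if_interior[OF wf])

lemma locally_compact_imp_continuous_KX:
  assumes wf: "well_filtered X" and lc: "locally_compact_nb X"
  shows "continuous_poset (KX X) kle"
proof -
  have "{u \<in> KX X. way_below (KX X) kle u K} = {Q \<in> KX X. K \<subseteq> X interior_of Q}" if "K \<in> KX X" for K
    using locally_compact_imp_property_Q[OF wf lc] that unfolding property_Q_def by blast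
  moreover have "dcpo_on (KX X) kle"
    unfolding dcpo_on_def using well_filtered_lub_iff[OF wf] by blast
  ultimately show ?thesis
    unfolding continuous_poset_def using locally_compact_KX_approx[OF lc] by simp
qed

section \<open>The upper Vietoris and the Scott topology\<close>

text \<open>The boxes form a base and not merely a subbase, since the boxes of \<open>U\<close> and
  \<open>V\<close> intersect in the box of \<open>U \<inter> V\<close>.\<close>

lemma openin_upper_vietoris_iff:
  "openin (upper_vietoris X) \<U> \<longleftrightarrow>
    \<U> \<subseteq> KX X \<and> (\<forall>K\<in>\<U>. \<exists>U. openin X U \<and> K \<subseteq> U \<and> box X U \<subseteq> \<U>)"
proof
  assume "openin (upper_vietoris X) \<U>"
  then have "generate_topology_on {box X U | U. openin X U} \<U>"
    unfolding upper_vietoris_def openin_topology_generated_by_iff .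
  then show "\<U> \<subseteq> KX X \<and> (\<forall>K\<in>\<U>. \<exists>U. openin X U \<and> K \<subseteq> U \<and> box X U \<subseteq> \<U>)"
  proof induction
    case (Int a b)
    have "\<exists>U. openin X U \<and> K \<subseteq> U \<and> box X U \<subseteq> a \<inter> b" if K: "K \<in> a \<inter> b" for K
    proof -
      obtain U V where "openin X U" "K \<subseteq> U" "box X U \<subseteq> a" "openin X V" "K \<subseteq> V" "box X V \<subseteq> b"
        using Int.IH K by (meson IntE)
      then show ?thesis
        by (intro exI[of _ "U \<inter> V"]) (auto simp: box_def)
    qed
    moreover have "a \<inter> b \<subseteq> KX X"
      using Int.IH by auto
    ultimately show ?case
      by simp
  next
    case (UN \<K>)
    then show ?case
      by (fastforce intro: order_trans[OF _ Union_upper])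
  next
    case (Basis s)
    then show ?case
      unfolding box_def by blast
  qed simp
next
  assume A: "\<U> \<subseteq> KX X \<and> (\<forall>K\<in>\<U>. \<exists>U. openin X U \<and> K \<subseteq> U \<and> box X U \<subseteq> \<U>)"
  have "openin (upper_vietoris X) (box X U)" if "openin X U" for U
    unfolding upper_vietoris_def using that by (intro topology_generated_by_Basis) blast
  moreover have "\<exists>T. (\<exists>U. openin X U \<and> T = box X U) \<and> K \<in> T \<and> T \<subseteq> \<U>" if "K \<in> \<U>" for K
    using A that unfolding box_def by blast
  ultimately show "openin (upper_vietoris X) \<U>"
    by (subst openin_subopen) metis
qed

lemma upper_vietoris_imp_scott_open:
  assumes wf: "well_filtered X" and op: "openin (upper_vietoris X) \<U>"
  shows "scott_open (KX X) kle \<U>"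
  unfolding scott_open_def
proof (intro conjI allI impI ballI)
  show "\<U> \<subseteq> KX X"
    using op unfolding openin_upper_vietoris_iff by blast
next
  fix K L assume K: "K \<in> \<U>" "L \<in> KX X" "kle K L"
  then obtain U where "K \<subseteq> U" "box X U \<subseteq> \<U>"
    using op unfolding openin_upper_vietoris_iff by blast
  then show "L \<in> \<U>"
    using K unfolding kle_def box_def by blast
next
  fix D s assume D: "directed_in (KX X) kle D \<and> is_lub_in (KX X) kle D s \<and> s \<in> \<U>"
  then obtain U where U: "openin X U" "s \<subseteq> U" "box X U \<subseteq> \<U>"
    using op unfolding openin_upper_vietoris_iff by blast
  have "\<Inter>D \<subseteq> U"
    using well_filtered_lub_iff[OF wf] D U by blast
  then obtain K where "K \<in> D" "K \<subseteq> U"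
    using well_filteredD[OF wf _ U(1)] D by meson
  then show "D \<inter> \<U> \<noteq> {}"
    using D U unfolding box_def directed_in_def by blast
qed

text \<open>\<open>K\<close> is the directed supremum of its compact saturated neighborhoods, so a
  Scott open set containing \<open>K\<close> contains one of them, \<open>Q\<close>. Being an upper
  set, it then contains the whole box of the interior of \<open>Q\<close>.\<close>

lemma locally_compact_scott_open_imp_upper_vietoris:
  assumes lc: "locally_compact_nb X" and sc: "scott_open (KX X) kle \<U>"
  shows "openin (upper_vietoris X) \<U>"
  unfolding openin_upper_vietoris_iff
proof (intro conjI ballI)
  show sub: "\<U> \<subseteq> KX X"
    using sc unfolding scott_open_def by blast
  fix K assume K: "K \<in> \<U>"
  then have "{Q \<in> KX X. K \<subseteq> X interior_of Q} \<inter> \<U> \<noteq> {}"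
    using sc locally_compact_KX_approx[OF lc, of K] sub unfolding scott_open_def by (meson subsetD)
  then obtain Q where Q: "Q \<in> \<U>" "K \<subseteq> X interior_of Q"
    by blast
  have "box X (X interior_of Q) \<subseteq> \<U>"
  proof
    fix L assume "L \<in> box X (X interior_of Q)"
    then have "L \<in> KX X" "kle Q L"
      using interior_of_subset[of X Q] unfolding box_def kle_def by auto
    then show "L \<in> \<U>"
      using sc Q(1) unfolding scott_open_def by blast
  qed
  then show "\<exists>U. openin X U \<and> K \<subseteq> U \<and> box X U \<subseteq> \<U>"
    using Q(2) openin_interior_of[of X Q] by blast
qed

text \<open>Continuity of \<open>upset X\<close> into the upper Vietoris topology: the preimage of
  the box of an open \<open>U\<close> is \<open>U\<close> itself. Once the two topologies agree,
  this is continuity into the Scott topology.\<close>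

lemma upper_vietoris_upset_preimage_open:
  assumes "openin (upper_vietoris X) \<U>"
  shows "openin X {x \<in> topspace X. upset X x \<in> \<U>}"
proof (subst openin_subopen, intro ballI)
  fix x assume x: "x \<in> {x \<in> topspace X. upset X x \<in> \<U>}"
  then obtain U where U: "openin X U" "upset X x \<subseteq> U" "box X U \<subseteq> \<U>"
    using assms unfolding openin_upper_vietoris_iff by blast
  have "U \<subseteq> {x \<in> topspace X. upset X x \<in> \<U>}"
  proof
    fix y assume y: "y \<in> U"
    then have "y \<in> topspace X"
      using openin_subset[OF U(1)] by blast
    then have "upset X y \<in> box X U"
      using upset_in_KX[of y X] upset_subset_open[OF U(1) y] unfolding box_def by simp
    then show "y \<in> {x \<in> topspace X. upset X x \<in> \<U>}"
      using U \<open>y \<in> topspace X\<close> by blast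
  qed
  moreover have "x \<in> U"
    using U(2) mem_upset[of x X] x by blast
  ultimately show "\<exists>T. openin X T \<and> x \<in> T \<and> T \<subseteq> {x \<in> topspace X. upset X x \<in> \<U>}"
    using U(1) by (intro exI conjI)
qed

section \<open>From continuity of \<open>KX X\<close> back to local compactness\<close>

lemma upset_continuous_imp_locally_compact:
  assumes wf: "well_filtered X" and c: "continuous_poset (KX X) kle"
    and xi: "\<And>\<U>. scott_open (KX X) kle \<U> \<Longrightarrow> openin X {x \<in> topspace X. upset X x \<in> \<U>}"
  shows "locally_compact_nb X"
  unfolding locally_compact_nb_def
proof (intro ballI allI impI)
  fix x U assume x: "x \<in> topspace X" and U: "openin X U \<and> x \<in> U"
  then obtain Q where Q: "Q \<in> KX X" "way_below (KX X) kle Q (upset X x)" "Q \<subseteq> U"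
    using continuous_KX_approx[OF wf c] by blast
  \<comment> \<open>The preimage under \<open>upset X\<close> of the Scott open set of all elements
    that \<open>Q\<close> is way below; it is the open neighborhood of \<open>x\<close> that
    \<open>Q\<close> has to contain.\<close>
  define V where "V = {y \<in> topspace X. upset X y \<in> {K \<in> KX X. way_below (KX X) kle Q K}}"
  have "openin X V"
    unfolding V_def using scott_open_way_above[OF c transp_kle reflp_kle] by (rule xi)
  moreover have "x \<in> V"
    unfolding V_def using x Q(2) upset_in_KX[OF x] by simp
  moreover have "V \<subseteq> Q"
  proof
    fix y assume "y \<in> V"
    then have y: "y \<in> topspace X" "way_below (KX X) kle Q (upset X y)"
      unfolding V_def by auto
    then have "upset X y \<subseteq> Q"
      using continuous_posetD(2)[OF c upset_in_KX[OF y(1)]] Q(1)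
      unfolding is_lub_in_def kle_def by blast
    then show "y \<in> Q"
      using mem_upset y by fastforce
  qed
  ultimately show "\<exists>V K. openin X V \<and> compactin X K \<and> x \<in> V \<and> V \<subseteq> K \<and> K \<subseteq> U"
    using Q unfolding KX_def by blast
qed

lemma property_Q_imp_locally_compact:
  assumes wf: "well_filtered X" and c: "continuous_poset (KX X) kle" and Q: "property_Q X"
  shows "locally_compact_nb X"
  unfolding locally_compact_nb_def
proof (intro ballI allI impI)
  fix x U assume x: "x \<in> topspace X" and U: "openin X U \<and> x \<in> U"
  then obtain K where K: "K \<in> KX X" "way_below (KX X) kle K (upset X x)" "K \<subseteq> U"
    using continuous_KX_approx[OF wf c] by blast
  then have "x \<in> X interior_of K"
    using Q upset_in_KX[OF x] mem_upset[OF x] unfolding property_Q_def by blast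
  then show "\<exists>V K. openin X V \<and> compactin X K \<and> x \<in> V \<and> V \<subseteq> K \<and> K \<subseteq> U"
    using K interior_of_subset[of X K] openin_interior_of[of X K] unfolding KX_def by blast
qed

section \<open>Core compact spaces\<close>

lemma is_lub_in_opens_iff:
  assumes "D \<subseteq> {U. openin X U}"
  shows "is_lub_in {U. openin X U} (\<subseteq>) D s \<longleftrightarrow> s = \<Union>D"
proof
  have op: "openin X (\<Union>D)"
    using assms by blast
  assume "is_lub_in {U. openin X U} (\<subseteq>) D s"
  then show "s = \<Union>D"
    unfolding is_lub_in_def using op by (metis Sup_least Union_upper mem_Collect_eq subset_antisym)
qed (use assms in \<open>auto simp: is_lub_in_def\<close>)

abbreviation way_inside :: "'a topology \<Rightarrow> 'a set \<Rightarrow> 'a set \<Rightarrow> bool" where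
  "way_inside X \<equiv> way_below {U. openin X U} (\<subseteq>)"

lemma way_inside_directed_cover:
  assumes "way_inside X V U" "directed_in {U. openin X U} (\<subseteq>) D" "U \<subseteq> \<Union>D"
  shows "\<exists>d\<in>D. V \<subseteq> d"
proof (rule way_belowD[OF assms(1,2) _ assms(3)])
  have "D \<subseteq> {U. openin X U}"
    using assms(2) by (rule directed_in_subset)
  then show "is_lub_in {U. openin X U} (\<subseteq>) D (\<Union>D)"
    by (simp only: is_lub_in_opens_iff)
qed

text \<open>Way-below among open sets is relative compactness. The finite unions from a cover form a
  directed family with the same union; conversely, a finite subfamily of a directed family lies
  below a single member.\<close>

lemma way_inside_iff_finite_subcover:
  "way_inside X V U \<longleftrightarrow>
    (\<forall>\<C>. (\<forall>C\<in>\<C>. openin X C) \<and> U \<subseteq> \<Union>\<C> \<longrightarrow> (\<exists>\<F>. finite \<F> \<and> \<F> \<subseteq> \<C> \<and> V \<subseteq> \<Union>\<F>))"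
proof (intro iffI allI impI)
  fix \<C> assume wi: "way_inside X V U" and \<C>: "(\<forall>C\<in>\<C>. openin X C) \<and> U \<subseteq> \<Union>\<C>"
  define D where "D = {\<Union>\<F> |\<F>. finite \<F> \<and> \<F> \<subseteq> \<C>}"
  have sub: "D \<subseteq> {U. openin X U}"
    using \<C> unfolding D_def by blast
  have "\<exists>c\<in>D. a \<subseteq> c \<and> b \<subseteq> c" if ab: "a \<in> D" "b \<in> D" for a b
  proof -
    obtain F G where FG: "finite F" "F \<subseteq> \<C>" "a = \<Union>F" "finite G" "G \<subseteq> \<C>" "b = \<Union>G"
      using ab unfolding D_def by blast
    then have "\<Union>(F \<union> G) \<in> D"
      unfolding D_def using finite_UnI[of F G] Un_least[of F \<C> G] by blast
    moreover have "a \<subseteq> \<Union>(F \<union> G)" "b \<subseteq> \<Union>(F \<union> G)"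
      using FG by auto
    ultimately show ?thesis
      by blast
  qed
  moreover have "D \<noteq> {}"
    unfolding D_def by blast
  ultimately have "directed_in {U. openin X U} (\<subseteq>) D"
    using sub unfolding directed_in_def by blast
  moreover have "U \<subseteq> \<Union>D"
  proof
    fix x assume "x \<in> U"
    then obtain C where "C \<in> \<C>" "x \<in> C"
      using \<C> by blast
    moreover from this have "\<Union>{C} \<in> D"
      unfolding D_def by blast
    ultimately show "x \<in> \<Union>D"
      by auto
  qed
  ultimately obtain d where "d \<in> D" "V \<subseteq> d"
    using way_inside_directed_cover[OF wi] by blast
  then show "\<exists>\<F>. finite \<F> \<and> \<F> \<subseteq> \<C> \<and> V \<subseteq> \<Union>\<F>"
    unfolding D_def by blast
next
  assume fin: "\<forall>\<C>. (\<forall>C\<in>\<C>. openin X C) \<and> U \<subseteq> \<Union>\<C> \<longrightarrow> (\<exists>\<F>. finite \<F> \<and> \<F> \<subseteq> \<C> \<and> V \<subseteq> \<Union>\<F>)"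
  show "way_inside X V U"
    unfolding way_below_def
  proof (intro allI impI)
    fix D s
    assume D: "directed_in {U. openin X U} (\<subseteq>) D \<and> is_lub_in {U. openin X U} (\<subseteq>) D s \<and> U \<subseteq> s"
    then have sub: "D \<subseteq> {U. openin X U}" and ne: "D \<noteq> {}"
      unfolding directed_in_def by auto
    have "(\<forall>C\<in>D. openin X C) \<and> U \<subseteq> \<Union>D"
      using D sub by (auto simp only: is_lub_in_opens_iff[OF sub])
    then obtain \<F> where \<F>: "finite \<F>" "\<F> \<subseteq> D" "V \<subseteq> \<Union>\<F>"
      using fin[rule_format, of D] by blast
    have ub: "\<exists>c\<in>D. a \<subseteq> c \<and> b \<subseteq> c" if "a \<in> D" "b \<in> D" for a b
      using D that unfolding directed_in_def by simp
    from \<F>(1,2) have "\<exists>d\<in>D. \<Union>\<F> \<subseteq> d"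
    proof induction
      case (insert a F)
      then obtain d where d: "d \<in> D" "\<Union>F \<subseteq> d" "a \<in> D"
        by auto
      obtain e where "e \<in> D" "a \<subseteq> e" "d \<subseteq> e"
        using ub[OF d(3,1)] by blast
      then show ?case
        using d(2) by (intro bexI[of _ e]) auto
    qed (use ne in blast)
    then show "\<exists>d\<in>D. V \<subseteq> d"
      using \<F>(3) by (meson order_trans)
  qed
qed

lemma way_inside_imp_subset:
  assumes "openin X U" "way_inside X V U"
  shows "V \<subseteq> U"
proof -
  obtain F where "F \<subseteq> {U}" "V \<subseteq> \<Union>F"
    using assms by (auto simp: way_inside_iff_finite_subcover dest!: spec[of _ "{U}"])
  then show ?thesis
    by blast
qed

text \<open>A compact set squeezed between \<open>V\<close> and \<open>U\<close> makes
  \<open>V\<close> way inside \<open>U\<close> by the finite subcover criterion, and local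
  compactness supplies such a \<open>V\<close> around every point of \<open>U\<close>.\<close>

lemma locally_compact_imp_core_compact:
  assumes lc: "locally_compact_nb X"
  shows "core_compact X"
  unfolding core_compact_def continuous_poset_def
proof (intro conjI ballI)
  show "dcpo_on {U. openin X U} (\<subseteq>)"
    unfolding dcpo_on_def
  proof (intro allI impI)
    fix D assume "directed_in {U. openin X U} (\<subseteq>) D"
    then have "D \<subseteq> {U. openin X U}"
      by (rule directed_in_subset)
    then show "\<exists>s. is_lub_in {U. openin X U} (\<subseteq>) D s"
      by (simp only: is_lub_in_opens_iff) blast
  qed
next
  fix U assume "U \<in> {U. openin X U}"
  then have U: "openin X U" by simp
  let ?D = "{V \<in> {U. openin X U}. way_inside X V U}"
  have "{} \<in> ?D"
    by (auto simp: way_inside_iff_finite_subcover)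
  moreover have "V \<union> W \<in> ?D" if VW: "V \<in> ?D" "W \<in> ?D" for V W
  proof -
    have "\<exists>\<F>. finite \<F> \<and> \<F> \<subseteq> \<C> \<and> V \<union> W \<subseteq> \<Union>\<F>"
      if \<C>: "(\<forall>C\<in>\<C>. openin X C) \<and> U \<subseteq> \<Union>\<C>" for \<C>
    proof -
      obtain F where F: "finite F" "F \<subseteq> \<C>" "V \<subseteq> \<Union>F"
        using VW(1) \<C> unfolding way_inside_iff_finite_subcover by blast
      obtain G where G: "finite G" "G \<subseteq> \<C>" "W \<subseteq> \<Union>G"
        using VW(2) \<C> unfolding way_inside_iff_finite_subcover by blast
      show ?thesis
        using F G by (intro exI[of _ "F \<union> G"]) auto
    qed
    then show ?thesis
      using VW by (auto simp: way_inside_iff_finite_subcover)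
  qed
  ultimately show "directed_in {U. openin X U} (\<subseteq>) ?D"
    unfolding directed_in_def by blast
  have "\<Union>?D = U"
  proof
    show "\<Union>?D \<subseteq> U"
      using way_inside_imp_subset[OF U] by blast
    show "U \<subseteq> \<Union>?D"
    proof
      fix x assume "x \<in> U"
      then obtain V K where VK: "openin X V" "compactin X K" "x \<in> V" "V \<subseteq> K" "K \<subseteq> U"
        using lc U openin_subset[OF U] unfolding locally_compact_nb_def by (meson subsetD)
      have "\<exists>\<F>. finite \<F> \<and> \<F> \<subseteq> \<C> \<and> V \<subseteq> \<Union>\<F>"
        if "(\<forall>C\<in>\<C>. openin X C) \<and> U \<subseteq> \<Union>\<C>" for \<C>
        using VK(2,4,5) that unfolding compactin_def by (meson order_trans)
      then have "V \<in> ?D"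
        using VK(1) by (auto simp: way_inside_iff_finite_subcover)
      then show "x \<in> \<Union>?D"
        using VK(3) by blast
    qed
  qed
  then show "is_lub_in {U. openin X U} (\<subseteq>) ?D U"
    using is_lub_in_opens_iff[of ?D X U] by auto
qed

section \<open>Descending way-below sequences of open sets\<close>

lemma way_inside_sequence:
  assumes cc: "core_compact X" and U: "openin X U" and V: "way_inside X V U"
  obtains W :: "nat \<Rightarrow> 'a set" where "W 0 = U" "\<And>n. openin X (W n)"
    "\<And>n. way_inside X (W (Suc n)) (W n)" "\<And>n. way_inside X V (W n)"
proof -
  have c: "continuous_poset {U. openin X U} (\<subseteq>)"
    using cc unfolding core_compact_def .
  have "\<exists>y. (openin X y \<and> way_inside X V y) \<and> way_inside X y x"
    if "openin X x \<and> way_inside X V x" for x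
    using way_below_interpolation[OF c _ _ conjunct2[OF that]] that
    by (metis mem_Collect_eq reflpI subset_refl transp_on_le)
  \<comment> \<open>Dependent choice iterates the interpolation between \<open>V\<close> and the
    current set; the conjunct \<open>n = 0 \<longrightarrow> x = U\<close> in the invariant fixes
    the starting term.\<close>
  then obtain W where "\<forall>n. (openin X (W n) \<and> way_inside X V (W n))
      \<and> way_inside X (W (Suc n)) (W n)" "W 0 = U"
    using dependent_nat_choice[of "\<lambda>n x. (openin X x \<and> way_inside X V x) \<and> (n = 0 \<longrightarrow> x = U)"
        "\<lambda>n x y. way_inside X y x"] U V
    by (metis nat.distinct(1))
  then show ?thesis
    using that by blast
qed

text \<open>Zorn's lemma applies because \<open>W (Suc n)\<close> is way inside \<open>W n\<close>:
  if the union of a chain contained \<open>W n\<close>, a single member of the chain would contain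
  \<open>W (Suc n)\<close>.\<close>

lemma maximal_open_avoiding:
  fixes W :: "nat \<Rightarrow> 'a set"
  assumes W: "\<And>n. openin X (W n)" "\<And>n. way_inside X (W (Suc n)) (W n)"
    and G: "openin X G" "\<And>n. \<not> W n \<subseteq> G"
  obtains M where "openin X M" "G \<subseteq> M" "\<And>n. \<not> W n \<subseteq> M"
    "\<And>O'. openin X O' \<Longrightarrow> M \<subseteq> O' \<Longrightarrow> (\<And>n. \<not> W n \<subseteq> O') \<Longrightarrow> O' = M"
proof -
  define \<A> where "\<A> = {O'. openin X O' \<and> G \<subseteq> O' \<and> (\<forall>n. \<not> W n \<subseteq> O')}"
  have "\<exists>M\<in>\<A>. \<forall>O'\<in>\<A>. M \<subseteq> O' \<longrightarrow> O' = M"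
  proof (rule subset_Zorn_nonempty)
    show "\<A> \<noteq> {}"
      using G unfolding \<A>_def by blast
    fix \<C> assume \<C>: "\<C> \<noteq> {}" "subset.chain \<A> \<C>"
    have sub: "\<C> \<subseteq> \<A>"
      using \<C>(2) unfolding subset.chain_def by blast
    have op: "\<C> \<subseteq> {U. openin X U}"
      using sub unfolding \<A>_def by blast
    have "\<exists>c\<in>\<C>. a \<subseteq> c \<and> b \<subseteq> c" if "a \<in> \<C>" "b \<in> \<C>" for a b
      using \<C>(2) that unfolding subset_chain_def by (metis subset_refl)
    then have dir: "directed_in {U. openin X U} (\<subseteq>) \<C>"
      using op \<C>(1) unfolding directed_in_def by blast
    have "\<not> W n \<subseteq> \<Union>\<C>" for n
    proof
      assume "W n \<subseteq> \<Union>\<C>"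
      then obtain C where "C \<in> \<C>" "W (Suc n) \<subseteq> C"
        using way_inside_directed_cover[OF W(2) dir] by blast
      then show False
        using sub unfolding \<A>_def by blast
    qed
    then show "\<Union>\<C> \<in> \<A>"
      using op sub \<C>(1) unfolding \<A>_def by blast
  qed
  then show ?thesis
    using that unfolding \<A>_def by (smt (verit) mem_Collect_eq order_trans)
qed

text \<open>A cover member containing \<open>x m\<close> misses only finitely many terms, and each
  missed term of the tail costs one more member.\<close>

lemma compactin_range_if_cofinite:
  fixes x :: "nat \<Rightarrow> 'a"
  assumes x: "\<And>n. x n \<in> topspace X"
    and cof: "\<And>U k. openin X U \<Longrightarrow> x k \<in> U \<Longrightarrow> finite {n. x n \<notin> U}"
  shows "compactin X (x ` {m..})"
  unfolding compactin_def
proof (intro conjI allI impI)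
  show "x ` {m..} \<subseteq> topspace X"
    using x by blast
  fix \<U> assume \<U>: "Ball \<U> (openin X) \<and> x ` {m..} \<subseteq> \<Union>\<U>"
  then have "\<forall>k\<in>{m..}. \<exists>U\<in>\<U>. x k \<in> U"
    by blast
  then obtain C where C: "\<And>k. k \<ge> m \<Longrightarrow> C k \<in> \<U> \<and> x k \<in> C k"
    by (metis atLeast_iff)
  define N where "N = {n. x n \<notin> C m}"
  have "finite N"
    unfolding N_def using cof C[of m] \<U> by blast
  moreover have "insert (C m) (C ` (N \<inter> {m..})) \<subseteq> \<U>"
    using C by auto
  moreover have "x ` {m..} \<subseteq> \<Union>(insert (C m) (C ` (N \<inter> {m..})))"
    using C unfolding N_def by auto
  ultimately show "\<exists>\<F>. finite \<F> \<and> \<F> \<subseteq> \<U> \<and> x ` {m..} \<subseteq> \<Union>\<F>"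
    by (meson finite_Int finite_imageI finite_insert)
qed

lemma well_filtered_way_inside_sequence:
  fixes W :: "nat \<Rightarrow> 'a set"
  assumes wf: "well_filtered X"
    and W: "\<And>n. openin X (W n)" "\<And>n. way_inside X (W (Suc n)) (W n)"
    and G: "openin X G" "(\<Inter>n. W n) \<subseteq> G"
  shows "\<exists>n. W n \<subseteq> G"
proof (rule ccontr)
  assume "\<nexists>n. W n \<subseteq> G"
  then obtain M where M: "openin X M" "G \<subseteq> M" "\<And>n. \<not> W n \<subseteq> M"
    and max: "\<And>O'. openin X O' \<Longrightarrow> M \<subseteq> O' \<Longrightarrow> (\<And>n. \<not> W n \<subseteq> O') \<Longrightarrow> O' = M"
    using maximal_open_avoiding[of X W G, OF W G(1)] by metis
  have anti: "W n \<subseteq> W m" if "m \<le> n" for m n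
    using lift_Suc_antimono_le[of W] way_inside_imp_subset[OF W] that by blast
  have "\<forall>n. \<exists>y. y \<in> W n \<and> y \<notin> M"
    using M(3) by blast
  then obtain x where x: "\<And>n. x n \<in> W n" "\<And>n. x n \<notin> M"
    by metis
  have xX: "x n \<in> topspace X" for n
    using x(1) openin_subset[OF W(1)] by blast
  \<comment> \<open>If \<open>U\<close> missed infinitely many terms, every \<open>W m\<close> would
    contain some \<open>x n\<close> with \<open>n \<ge> m\<close> outside
    \<open>M \<union> U\<close>. Maximality would then give \<open>U \<subseteq> M\<close>, contrary
    to \<open>x k \<in> U\<close> and \<open>x k \<notin> M\<close>.\<close>
  have cof: "finite {n. x n \<notin> U}" if U: "openin X U" "x k \<in> U" for U k
  proof (rule ccontr)
    assume inf: "infinite {n. x n \<notin> U}"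
    have "\<not> W m \<subseteq> M \<union> U" for m
    proof -
      obtain n where "n \<ge> m" "x n \<notin> U"
        using inf unfolding infinite_nat_iff_unbounded_le by blast
      then show ?thesis
        using x anti by blast
    qed
    then have "M \<union> U = M"
      using max[of "M \<union> U"] M(1) U(1) by blast
    then show False
      using U(2) x(2) by blast
  qed
  define T where "T m = saturation X (x ` {m..})" for m
  have TK: "T m \<in> KX X" for m
    unfolding T_def by (intro saturation_in_KX compactin_range_if_cofinite xX cof) auto
  have T_anti: "T n \<subseteq> T m" if "m \<le> n" for m n
    unfolding T_def using that by (intro saturation_mono) auto
  have "\<exists>c\<in>range T. kle a c \<and> kle b c" if ab: "a \<in> range T" "b \<in> range T" for a b
  proof -
    obtain i j where "a = T i" "b = T j"
      using ab by blast
    then show ?thesis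
      unfolding kle_def using T_anti[of i "max i j"] T_anti[of j "max i j"] by auto
  qed
  then have dir: "directed_in (KX X) kle (range T)"
    using TK unfolding directed_in_def by blast
  \<comment> \<open>The sequence \<open>W\<close> decreases, so the open set \<open>W m\<close>
    contains the whole tail from \<open>m\<close> on and hence its saturation.\<close>
  have "T m \<subseteq> W m" for m
    unfolding T_def using x(1) anti by (intro saturation_subset_open W(1)) blast
  then have "\<Inter>(range T) \<subseteq> (\<Inter>n. W n)"
    by (intro INF_mono')
  then have "\<Inter>(range T) \<subseteq> G"
    using G(2) by (rule order_trans)
  then obtain m where "T m \<subseteq> G"
    using well_filteredD[OF wf dir G(1)] by blast
  moreover have "x m \<in> T m"
    unfolding T_def using subset_saturation[of "x ` {m..}" X] xX by auto
  ultimately show False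
    using M(2) x(2) by blast
qed

lemma core_compact_imp_locally_compact:
  assumes wf: "well_filtered X" and cc: "core_compact X"
  shows "locally_compact_nb X"
  unfolding locally_compact_nb_def
proof (intro ballI allI impI)
  fix x U assume x: "x \<in> topspace X" and U: "openin X U \<and> x \<in> U"
  have c: "continuous_poset {U. openin X U} (\<subseteq>)"
    using cc unfolding core_compact_def .
  let ?D = "{V \<in> {U. openin X U}. way_inside X V U}"
  have "is_lub_in {U. openin X U} (\<subseteq>) ?D U"
    using continuous_posetD(2)[OF c, of U] U by blast
  then have "U = \<Union>?D"
    by (subst (asm) is_lub_in_opens_iff) blast+
  then obtain V where V: "openin X V" "way_inside X V U" "x \<in> V"
    using U by blast
  obtain W where W: "W 0 = U" "\<And>n. openin X (W n)"
    "\<And>n. way_inside X (W (Suc n)) (W n)" "\<And>n. way_inside X V (W n)"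
    using way_inside_sequence[OF cc _ V(2)] U by metis
  define K where "K = (\<Inter>n. W n)"
  have "V \<subseteq> K"
    unfolding K_def using way_inside_imp_subset W(2,4) by blast
  moreover have "K \<subseteq> U"
    unfolding K_def using W(1) by blast
  moreover have "compactin X K"
    unfolding compactin_def
  proof (intro conjI allI impI)
    show "K \<subseteq> topspace X"
      using \<open>K \<subseteq> U\<close> U openin_subset[of X U] by blast
    fix \<C> assume \<C>: "Ball \<C> (openin X) \<and> K \<subseteq> \<Union>\<C>"
    then have "openin X (\<Union>\<C>)"
      by blast
    then obtain n where "W n \<subseteq> \<Union>\<C>"
      using well_filtered_way_inside_sequence[of X W "\<Union>\<C>", OF wf W(2,3)] \<C> unfolding K_def by blast
    then obtain \<F> where "finite \<F>" "\<F> \<subseteq> \<C>" "W (Suc n) \<subseteq> \<Union>\<F>"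
      using W(3)[of n] \<C> unfolding way_inside_iff_finite_subcover by meson
    then show "\<exists>\<F>. finite \<F> \<and> \<F> \<subseteq> \<C> \<and> K \<subseteq> \<Union>\<F>"
      unfolding K_def by blast
  qed
  ultimately show "\<exists>V K. openin X V \<and> compactin X K \<and> x \<in> V \<and> V \<subseteq> K \<and> K \<subseteq> U"
    using V by blast
qed

theorem mainTheorem1:
  fixes X :: "'a topology"
  assumes "t0_space X" and "well_filtered X"
  shows "(locally_compact_nb X \<longleftrightarrow>
            continuous_poset (KX X) kle \<and>
            (\<forall>\<U>. openin (upper_vietoris X) \<U> \<longleftrightarrow> scott_open (KX X) kle \<U>))
       \<and> (locally_compact_nb X \<longleftrightarrow>
            continuous_poset (KX X) kle \<and>
            (\<forall>\<U>. scott_open (KX X) kle \<U> \<longrightarrow> openin X {x \<in> topspace X. upset X x \<in> \<U>}))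
       \<and> (locally_compact_nb X \<longleftrightarrow> continuous_poset (KX X) kle \<and> property_Q X)
       \<and> (locally_compact_nb X \<longleftrightarrow> core_compact X)"
proof -
  note wf = assms(2)
  \<comment> \<open>The first two equivalences close a cycle: local compactness, coincidence of the
    topologies, continuity of \<open>upset X\<close>, local compactness. Property Q and core
    compactness are each compared with local compactness directly.\<close>
  have "continuous_poset (KX X) kle \<and>
      (\<forall>\<U>. openin (upper_vietoris X) \<U> \<longleftrightarrow> scott_open (KX X) kle \<U>)"
    if "locally_compact_nb X"
    using locally_compact_imp_continuous_KX[OF wf that] upper_vietoris_imp_scott_open[OF wf]
      locally_compact_scott_open_imp_upper_vietoris[OF that] by blast
  moreover have "\<forall>\<U>. scott_open (KX X) kle \<U> \<longrightarrow> openin X {x \<in> topspace X. upset X x \<in> \<U>}"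
    if "\<forall>\<U>. openin (upper_vietoris X) \<U> \<longleftrightarrow> scott_open (KX X) kle \<U>"
    using upper_vietoris_upset_preimage_open that by blast
  moreover note upset_continuous_imp_locally_compact[OF wf]
    locally_compact_imp_property_Q[OF wf] property_Q_imp_locally_compact[OF wf]
    locally_compact_imp_core_compact core_compact_imp_locally_compact[OF wf]
  ultimately show ?thesis
    by meson
qed

end
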